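(* Consider a core-selecting mechanism for the reverse auction with bidder set $L$. (i) A group of bidders who lose when bidding their true values cannot profit by a joint deviation: let $K\subseteq L$, let $\mathcal{C}_K=\{c_l\}_{l\in K}$ be the true costs of the bidders in $K$, let $\mathcal{B}_{-K}$ be arbitrary bids of the bidders in $L\setminus K$, and suppose that under $\hat{\mathcal{C}}=(\mathcal{C}_K,\mathcal{B}_{-K})$ one has $x_l^*(\hat{\mathcal{C}})=0$ for all $l\in K$. Then for every family of bids $\mathcal{B}_K=\{b_l\}_{l\in K}$, with $\mathcal{B}=(\mathcal{B}_K,\mathcal{B}_{-K})$, one has $\sum_{l\in K}u_l(\mathcal{B})\le\sum_{l\in K}u_l(\hat{\mathcal{C}})=0$. (ii) Bidding with multiple identities is unprofitable for all bidders with respect to the VCG utilities: let $l\in L$ have true cost $c_l$, let $\mathcal{C}=(\mathcal{C}_{-l},c_l)$ with $\mathcal{C}_{-l}$ arbitrary bids of the others, let $S$ be a finite set of identities (disjoint from $L\setminus\{l\}$) with bids $\mathcal{B}_S=\{b_k\}_{k\in S}$, and let $\mathcal{B}=(\mathcal{C}_{-l},\mathcal{B}_S)$ be the profile in which bidder $l$ is replaced by the identities in $S$. Then, with $p$ the payments of the core-selecting mechanism, $$\sum_{k\in S}p_k(\mathcal{B})-c_l\Big(\sum_{k\in S}x_k^*(\mathcal{B})\Big)\le u_l^{\mathrm{VCG}}(\mathcal{C}).$$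
   Context: Reverse auction. $L$ is a finite set of bidders, $t$ the number of types of goods, $d:\mathbb{R}_+^{t|L|}\times\mathbb{R}^p\to\mathbb{R}$ and $g:\mathbb{R}_+^{t|L|}\times\mathbb{R}^p\to\mathbb{R}^q$ given functions. Each bidder has a true cost $c_l$ and submits a bid $b_l$; all true costs and bids are nondecreasing functions $\mathbb{R}_+^t\to\mathbb{R}_+$ vanishing at $0$. For a bid profile $\mathcal{B}=\{b_l\}_{l\in L}$ and $S\subseteq L$, $$J(\mathcal{B}_S)=\min_{x,y}\ \sum_{l\in S}b_l(x_l)+d(x,y)\quad\text{s.t. } g(x,y)\le0,\ x_l=0\ \ \forall l\in L\setminus S,$$ with $x\in\mathbb{R}_+^{t|L|}$, $y\in\mathbb{R}^p$, and value $+\infty$ if infeasible; $J(\mathcal{B})=J(\mathcal{B}_L)$, $\mathcal{B}_{-l}=\mathcal{B}_{L\setminus\{l\}}$. Minima of feasible problems are assumed attained, $J$ is finite for the full profiles considered, and in (ii) $J(\mathcal{C}_{-l})<\infty$. $(x^*(\mathcal{B}),y^*(\mathcal{B}))$ is the optimal solution for $S=L$ chosen by a fixed tie-breaking rule. Revealed core: $$Core(\mathcal{B})=\Big\{\bar u\in\mathbb{R}\times\mathbb{R}_+^{|L|}\ \Big|\ \bar u_0+\sum_{l\in L}\bar u_l=-J(\mathcal{B}),\ \bar u_0+\sum_{l\in S}\bar u_l\ge-J(\mathcal{B}_S)\ \ \forall S\subset L\Big\}.$$ A core-selecting mechanism uses the allocation $x^*(\mathcal{B})$ and payments $p_l(\mathcal{B})=b_l(x_l^*(\mathcal{B}))+\bar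 u_l(\mathcal{B})$, where for each bid profile $\bar u(\mathcal{B})\in Core(\mathcal{B})$. The utility of bidder $l$ with true cost $c_l$ is $u_l(\mathcal{B})=p_l(\mathcal{B})-c_l(x_l^*(\mathcal{B}))$. VCG utility (Clarke pivot rule) of bidder $l$ bidding truthfully in $\mathcal{C}$: $u_l^{\mathrm{VCG}}(\mathcal{C})=J(\mathcal{C}_{-l})-J(\mathcal{C})$. Fungibility (relevant to (ii)): goods of the same type from different bidders are fungible to the central operator, i.e. $g(x,y)=G(\sum_l x_l,y)$ and $d(x,y)=D(\sum_l x_l,y)$ for fixed functions $G:\mathbb{R}_+^t\times\mathbb{R}^p\to\mathbb{R}^q$, $D:\mathbb{R}_+^t\times\mathbb{R}^p\to\mathbb{R}$. Hence the auction and the mechanism are defined in the same way for any finite set of bidders, in particular for $(L\setminus\{l\})\cup S$. *)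

theory Defs
  imports "HOL-Analysis.Analysis"
begin

text \<open>
  A point of $\mathbb{R}_+^{t|L|}$ is a function on the type of all potential bidders that vanishes
  outside the bidder set $L$; points of $\mathbb{R}^{|L|}$ are treated in the same way.
  The orders on \<^typ>\<open>real ^ 't\<close> and \<^typ>\<open>real ^ 'q\<close> are componentwise.
\<close>

type_synonym 't bid = "real ^ 't \<Rightarrow> real"
type_synonym ('l, 't) profile = "'l \<Rightarrow> 't bid"
type_synonym ('l, 't) allocation = "'l \<Rightarrow> real ^ 't"

definition valid_bid :: "('t::finite) bid \<Rightarrow> bool" where
  "valid_bid b \<longleftrightarrow> mono_on {0..} b \<and> b \<in> {0..} \<rightarrow> {0..} \<and> b 0 = 0"

definition valid_profile :: "'l set \<Rightarrow> ('l, 't::finite) profile \<Rightarrow> bool" where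
  "valid_profile L B \<longleftrightarrow> (\<forall>l\<in>L. valid_bid (B l))"

record ('l, 't, 'p, 'q) auction =
  bidders :: "'l set"
  d_fun :: "('l, 't) allocation \<Rightarrow> real ^ 'p \<Rightarrow> real"
  g_fun :: "('l, 't) allocation \<Rightarrow> real ^ 'p \<Rightarrow> real ^ 'q"

definition allocations :: "'l set \<Rightarrow> ('l, 't::finite) allocation set" where
  "allocations L = {x. (\<forall>l\<in>L. 0 \<le> x l) \<and> (\<forall>l. l \<notin> L \<longrightarrow> x l = 0)}"

definition feasible ::
  "('l, 't::finite, 'p::finite, 'q::finite) auction \<Rightarrow> 'l set \<Rightarrow> (('l, 't) allocation \<times> (real ^ 'p)) set"
where
  "feasible A S =
     {(x, y). x \<in> allocations (bidders A) \<and> g_fun A x y \<le> 0 \<and> (\<forall>l \<in> bidders A - S. x l = 0)}"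

definition cost ::
  "('l, 't::finite, 'p::finite, 'q::finite) auction \<Rightarrow> ('l, 't) profile \<Rightarrow> 'l set \<Rightarrow>
   ('l, 't) allocation \<times> (real ^ 'p) \<Rightarrow> real"
where
  "cost A B S z = (\<Sum>l\<in>S. B l (fst z l)) + d_fun A (fst z) (snd z)"

definition optimal ::
  "('l, 't::finite, 'p::finite, 'q::finite) auction \<Rightarrow> ('l, 't) profile \<Rightarrow> 'l set \<Rightarrow>
   (('l, 't) allocation \<times> (real ^ 'p)) set"
where
  "optimal A B S = {z \<in> feasible A S. \<forall>w \<in> feasible A S. cost A B S z \<le> cost A B S w}"

text \<open>
  \<open>J A B S\<close> is $J(\mathcal{B}_S)$. The infimum in the extended reals is \<open>\<infinity>\<close> for an infeasible
  problem, and is the minimum whenever the minimum is attained.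
\<close>

definition J ::
  "('l, 't::finite, 'p::finite, 'q::finite) auction \<Rightarrow> ('l, 't) profile \<Rightarrow> 'l set \<Rightarrow> ereal"
where
  "J A B S = (INF z \<in> feasible A S. ereal (cost A B S z))"

definition well_posed ::
  "('l, 't::finite, 'p::finite, 'q::finite) auction \<Rightarrow> ('l, 't) profile \<Rightarrow> bool"
where
  "well_posed A B \<longleftrightarrow>
     \<bar>J A B (bidders A)\<bar> \<noteq> \<infinity> \<and>
     (\<forall>S \<subseteq> bidders A. feasible A S \<noteq> {} \<longrightarrow> optimal A B S \<noteq> {})"

definition Core ::
  "('l, 't::finite, 'p::finite, 'q::finite) auction \<Rightarrow> ('l, 't) profile \<Rightarrow> (real \<times> ('l \<Rightarrow> real)) set"
where
  "Core A B =
     {(u0, u). (\<forall>l \<in> bidders A. 0 \<le> u l) \<and> (\<forall>l. l \<notin> bidders A \<longrightarrow> u l = 0) \<and>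
        ereal (u0 + (\<Sum>l \<in> bidders A. u l)) = - J A B (bidders A) \<and>
        (\<forall>S. S \<subset> bidders A \<longrightarrow> ereal (u0 + (\<Sum>l\<in>S. u l)) \<ge> - J A B S)}"

text \<open>
  A mechanism fixes, for each bid profile, the optimal solution selected by the tie-breaking rule
  and the revealed utilities (operator first). Being core-selecting constrains it only at
  profiles with finite optimal value and attained minima: elsewhere there may be no optimal
  solution, and the core is empty if the optimal value is infinite.
\<close>

record ('l, 't, 'p) mechanism =
  opt_sol :: "('l, 't) profile \<Rightarrow> ('l, 't) allocation \<times> (real ^ 'p)"
  ubar :: "('l, 't) profile \<Rightarrow> real \<times> ('l \<Rightarrow> real)"

definition core_selecting ::
  "('l, 't::finite, 'p::finite, 'q::finite) auction \<Rightarrow> ('l, 't, 'p) mechanism \<Rightarrow> bool"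
where
  "core_selecting A M \<longleftrightarrow>
     (\<forall>B. valid_profile (bidders A) B \<and> well_posed A B \<longrightarrow>
        opt_sol M B \<in> optimal A B (bidders A) \<and> ubar M B \<in> Core A B)"

definition xstar :: "('l, 't::finite, 'p::finite) mechanism \<Rightarrow> ('l, 't) profile \<Rightarrow> ('l, 't) allocation" where
  "xstar M B = fst (opt_sol M B)"

definition payment :: "('l, 't::finite, 'p::finite) mechanism \<Rightarrow> ('l, 't) profile \<Rightarrow> 'l \<Rightarrow> real" where
  "payment M B l = B l (xstar M B l) + snd (ubar M B) l"

definition utility ::
  "('l, 't::finite, 'p::finite) mechanism \<Rightarrow> ('l, 't) profile \<Rightarrow> ('l, 't) profile \<Rightarrow> 'l \<Rightarrow> real"
where
  "utility M c B l = payment M B l - c l (xstar M B l)"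

definition vcg_utility ::
  "('l, 't::finite, 'p::finite, 'q::finite) auction \<Rightarrow> ('l, 't) profile \<Rightarrow> 'l \<Rightarrow> ereal"
where
  "vcg_utility A C l = J A C (bidders A - {l}) - J A C (bidders A)"

definition fungible_auction ::
  "(real ^ 't \<Rightarrow> real ^ 'p \<Rightarrow> real) \<Rightarrow> (real ^ 't \<Rightarrow> real ^ 'p \<Rightarrow> real ^ 'q) \<Rightarrow> 'l set \<Rightarrow>
   ('l, 't::finite, 'p::finite, 'q::finite) auction"
where
  "fungible_auction D G L =
     \<lparr>bidders = L, d_fun = (\<lambda>x. D (\<Sum>l\<in>L. x l)), g_fun = (\<lambda>x. G (\<Sum>l\<in>L. x l))\<rparr>"

end

theory Submission
  imports Defs
begin

text \<open>
  The core constraint for a coalition \<open>T\<close> says that the payments to the bidders outside \<open>T\<close>, plus the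
  bids of \<open>T\<close> and the term \<open>d\<close> at the optimum, are at most $J(\mathcal{B}_T)$, which does not depend
  on the bids of the
  bidders outside \<open>T\<close>. In both parts \<open>T\<close> is the set of non-deviating bidders, and the allocation chosen
  under the deviation is a feasible candidate in the truthful problem, which bounds the truthful
  optimal cost from above. For (i), $J(\mathcal{B}_T)$ is in turn at most the truthful optimal cost,
  because the losers receive nothing; for (ii), the candidate
  gives \<open>l\<close> the aggregate of the goods bought from the identities.
\<close>

lemma J_le_cost: "z \<in> feasible A S \<Longrightarrow> J A B S \<le> ereal (cost A B S z)"
  unfolding J_def by (rule INF_lower)

lemma J_eq_cost:
  assumes "z \<in> optimal A B S"
  shows "J A B S = ereal (cost A B S z)"
proof (rule antisym)
  show "J A B S \<le> ereal (cost A B S z)"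
    using assms by (intro J_le_cost) (simp add: optimal_def)
  show "ereal (cost A B S z) \<le> J A B S"
    using assms unfolding J_def by (intro INF_greatest) (simp add: optimal_def)
qed

lemma cost_cong:
  assumes "\<And>k. k \<in> S \<Longrightarrow> B k = B' k"
  shows "cost A B S = cost A B' S"
  using assms by (simp add: cost_def fun_eq_iff cong: sum.cong)

lemma J_cong:
  assumes "\<And>k. k \<in> S \<Longrightarrow> B k = B' k"
  shows "J A B S = J A B' S"
  using cost_cong[of S B B' A] assms by (simp add: J_def)

lemma cost_split:
  assumes "finite S" "T \<subseteq> S"
  shows "cost A B S z = (\<Sum>k\<in>S - T. B k (fst z k)) + cost A B T z"
  using sum.subset_diff[OF assms(2,1), of "\<lambda>k. B k (fst z k)"] by (simp add: cost_def)

text \<open>The optimum \<open>z\<close> gives nothing to \<open>K\<close>, so it stays feasible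
  once \<open>K\<close> is excluded. Its cost does not change either, because the bids of
  \<open>K\<close> vanish at 0.\<close>

lemma J_le_J_if_losing:
  assumes "finite (bidders A)" "K \<subseteq> bidders A" "z \<in> optimal A B (bidders A)"
    and "\<And>k. k \<in> K \<Longrightarrow> fst z k = 0" "\<And>k. k \<in> K \<Longrightarrow> B k 0 = 0"
  shows "J A B (bidders A - K) \<le> J A B (bidders A)"
proof -
  have "z \<in> feasible A (bidders A - K)"
    using assms by (auto simp: optimal_def feasible_def)
  moreover have "cost A B (bidders A) z = cost A B (bidders A - K) z"
    using assms by (subst cost_split[of _ "bidders A - K"]) (auto intro!: sum.neutral)
  ultimately show ?thesis
    using J_le_cost J_eq_cost[OF assms(3)] by metis
qed

lemma Core_nonneg: "v \<in> Core A B \<Longrightarrow> k \<in> bidders A \<Longrightarrow> 0 \<le> snd v k"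
  by (auto simp: Core_def)

lemma payments_le_J:
  assumes "finite (bidders A)" "core_selecting A M"
    and "valid_profile (bidders A) B" "well_posed A B" "T \<subseteq> bidders A"
  shows "ereal ((\<Sum>k\<in>bidders A - T. payment M B k) + cost A B T (opt_sol M B)) \<le> J A B T"
proof -
  let ?z = "opt_sol M B"
  obtain u0 u where u: "ubar M B = (u0, u)" by fastforce
  have opt: "?z \<in> optimal A B (bidders A)" and core: "(u0, u) \<in> Core A B"
    using assms(2-4) u by (auto simp: core_selecting_def)
  have J: "J A B (bidders A) = ereal (cost A B (bidders A) ?z)"
    by (rule J_eq_cost[OF opt])
  have tot: "u0 + (\<Sum>k\<in>bidders A. u k) = - cost A B (bidders A) ?z"
    using core by (simp add: Core_def J)
  \<comment> \<open>\<open>Core\<close> states the inequality for proper subsets only; for the full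
    set it follows from the equality.\<close>
  have "- J A B T \<le> ereal (u0 + (\<Sum>k\<in>T. u k))"
    using core assms(5) by (cases "T = bidders A") (auto simp: Core_def)
  then have le: "ereal (- u0 - (\<Sum>k\<in>T. u k)) \<le> J A B T"
    by (cases "J A B T") auto
  have "(\<Sum>k\<in>bidders A - T. payment M B k) =
      (\<Sum>k\<in>bidders A - T. B k (fst ?z k)) + (\<Sum>k\<in>bidders A - T. u k)"
    by (simp add: payment_def xstar_def u sum.distrib)
  moreover have "(\<Sum>k\<in>bidders A. u k) = (\<Sum>k\<in>bidders A - T. u k) + (\<Sum>k\<in>T. u k)"
    by (rule sum.subset_diff[OF assms(5,1)])
  ultimately have "(\<Sum>k\<in>bidders A - T. payment M B k) + cost A B T ?z = - u0 - (\<Sum>k\<in>T. u k)"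
    using tot cost_split[OF assms(1,5), of A B ?z] by linarith
  with le show ?thesis by simp
qed

lemma valid_profile_override_on:
  assumes "valid_profile K c" "valid_profile (L - K) B"
  shows "valid_profile L (override_on B c K)"
  using assms by (auto simp: valid_profile_def override_on_def)

text \<open>The core constraint for the complement of \<open>K\<close> squeezes the total payment to
  \<open>K\<close> from above by 0, since the optimal cost is the same with and without the losers.
  Each single payment is nonnegative.\<close>

lemma losing_utilities_sum_0:
  assumes "finite (bidders A)" "core_selecting A M" "K \<subseteq> bidders A"
    and "valid_profile (bidders A) C" "well_posed A C" "\<And>k. k \<in> K \<Longrightarrow> xstar M C k = 0"
  shows "(\<Sum>k\<in>K. utility M C C k) = 0"
proof -
  let ?T = "bidders A - K" and ?z = "opt_sol M C"
  have T: "bidders A - ?T = K" using assms(3) by auto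
  have opt: "?z \<in> optimal A C (bidders A)" and core: "ubar M C \<in> Core A C"
    using assms(2,4,5) by (auto simp: core_selecting_def)
  have zero: "C k 0 = 0" if "k \<in> K" for k
    using assms(3,4) that by (auto simp: valid_profile_def valid_bid_def)
  have z0: "fst ?z k = 0" if "k \<in> K" for k
    using assms(6)[OF that] by (simp add: xstar_def)
  have "ereal ((\<Sum>k\<in>K. payment M C k) + cost A C ?T ?z) \<le> J A C ?T"
    using payments_le_J[OF assms(1,2,4,5), of ?T] by (simp add: T)
  also have "\<dots> \<le> J A C (bidders A)"
    by (intro J_le_J_if_losing[OF assms(1,3) opt]) (simp_all add: z0 zero)
  also have "\<dots> = ereal (cost A C (bidders A) ?z)"
    by (rule J_eq_cost[OF opt])
  also have "cost A C (bidders A) ?z = cost A C ?T ?z"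
    using cost_split[OF assms(1), of ?T A C ?z] by (simp add: T z0 zero)
  finally have "(\<Sum>k\<in>K. payment M C k) \<le> 0" by simp
  moreover have "utility M C C k = payment M C k" if "k \<in> K" for k
    using that by (simp add: utility_def assms(6) zero)
  \<comment> \<open>A loser is paid its bid at 0, which is 0, plus its revealed utility, which is
    nonnegative in the core.\<close>
  moreover have "payment M C k \<ge> 0" if "k \<in> K" for k
    using that Core_nonneg[OF core] assms(3) by (auto simp: payment_def assms(6) zero)
  ultimately show ?thesis
    by (simp add: sum_nonneg antisym)
qed

text \<open>\<open>C\<close> serves both as the truthful profile and as the cost profile in
  \<open>utility\<close>: on \<open>K\<close> it consists of the true costs, and the sum runs over
  \<open>K\<close> only.\<close>

lemma losing_group_deviation:
  assumes "finite (bidders A)" "core_selecting A M" "K \<subseteq> bidders A"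
    and "valid_profile (bidders A) C" "well_posed A C" "\<And>k. k \<in> K \<Longrightarrow> xstar M C k = 0"
    and "valid_profile (bidders A) B" "well_posed A B" "\<And>k. k \<in> bidders A - K \<Longrightarrow> B k = C k"
  shows "(\<Sum>k\<in>K. utility M C B k) \<le> 0"
proof -
  let ?T = "bidders A - K" and ?z = "opt_sol M B"
  have T: "bidders A - ?T = K" using assms(3) by auto
  have feas: "?z \<in> feasible A (bidders A)" and opt: "opt_sol M C \<in> optimal A C (bidders A)"
    using assms(2,4,5,7,8) by (auto simp: core_selecting_def optimal_def)
  have "ereal ((\<Sum>k\<in>K. payment M B k) + cost A B ?T ?z) \<le> J A B ?T"
    using payments_le_J[OF assms(1,2,7,8), of ?T] by (simp add: T)
  also have "\<dots> = J A C ?T"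
    by (rule J_cong[OF assms(9)])
  also have "\<dots> \<le> J A C (bidders A)"
    using assms(3,4,6)
    by (intro J_le_J_if_losing[OF assms(1,3) opt])
       (auto simp: xstar_def valid_profile_def valid_bid_def)
  \<comment> \<open>Feasibility does not depend on the bids, so the solution chosen under
    \<open>B\<close> may be priced at \<open>C\<close>.\<close>
  also have "\<dots> \<le> ereal (cost A C (bidders A) ?z)"
    by (rule J_le_cost[OF feas])
  \<comment> \<open>The cost of \<open>?T\<close> now stands on both ends of the chain and cancels;
    payments minus true costs of \<open>K\<close> remain.\<close>
  also have "cost A C (bidders A) ?z = (\<Sum>k\<in>K. C k (xstar M B k)) + cost A B ?T ?z"
    using cost_split[OF assms(1), of ?T A C ?z] cost_cong[of ?T B C A] assms(9)
    by (simp add: T xstar_def)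
  finally show ?thesis
    by (simp add: utility_def sum_subtractf)
qed

lemma fungible_auction_simps [simp]:
  "bidders (fungible_auction D G L) = L"
  "d_fun (fungible_auction D G L) x = D (\<Sum>k\<in>L. x k)"
  "g_fun (fungible_auction D G L) x = G (\<Sum>k\<in>L. x k)"
  by (simp_all add: fungible_auction_def)

text \<open>Excluded bidders supply 0, so the totals entering \<open>D\<close> and \<open>G\<close>
  are sums over \<open>T\<close> alone. This makes values from auctions with different bidder sets
  comparable.\<close>

lemma J_fungible_auction:
  assumes "finite L" "T \<subseteq> L"
  shows "J (fungible_auction D G L) B T = J (fungible_auction D G T) B T"
proof -
  have sum: "(\<Sum>k\<in>L. x k) = (\<Sum>k\<in>T. x k)" if "\<And>k. k \<notin> T \<Longrightarrow> x k = 0" for x :: "'a \<Rightarrow> real ^ 'b"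
    using that assms by (intro sum.mono_neutral_right) auto
  have vanish: "fst z k = 0" if "z \<in> feasible (fungible_auction D G L) T" "k \<notin> T" for z k
    using that by (cases "k \<in> L") (auto simp: feasible_def allocations_def)
  have "feasible (fungible_auction D G L) T = feasible (fungible_auction D G T) T" (is "?F = ?F'")
  proof (intro set_eqI iffI)
    fix z assume z: "z \<in> ?F"
    then show "z \<in> ?F'"
      using vanish[OF z] sum[of "fst z"] assms(2) by (auto simp: feasible_def allocations_def)
  next
    fix z assume z: "z \<in> ?F'"
    then have "\<And>k. k \<notin> T \<Longrightarrow> fst z k = 0" by (auto simp: feasible_def allocations_def)
    with z show "z \<in> ?F"
      using sum[of "fst z"] assms(2) by (auto simp: feasible_def allocations_def)
  qed
  moreover have "cost (fungible_auction D G L) B T z = cost (fungible_auction D G T) B T z"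
    if "z \<in> feasible (fungible_auction D G L) T" for z
    using sum[of "fst z"] vanish[OF that] by (simp add: cost_def)
  ultimately show ?thesis
    unfolding J_def by (metis (no_types, lifting) INF_cong)
qed

lemma multiple_identities:
  fixes D :: "real ^ 't::finite \<Rightarrow> real ^ 'p::finite \<Rightarrow> real"
    and G :: "real ^ 't \<Rightarrow> real ^ 'p \<Rightarrow> real ^ 'q::finite"
  defines "A \<equiv> fungible_auction D G"
  assumes L: "finite L" "l \<in> L" and S: "finite S" "S \<inter> (L - {l}) = {}"
    and N: "N = (L - {l}) \<union> S"
    and C: "well_posed (A L) C"
    and M: "core_selecting (A N) M"
    and B: "valid_profile N B" "well_posed (A N) B" "\<And>k. k \<in> L - {l} \<Longrightarrow> B k = C k"
  shows "ereal ((\<Sum>k\<in>S. payment M B k) - C l (\<Sum>k\<in>S. xstar M B k)) \<le> vcg_utility (A L) C l"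
proof -
  let ?T = "L - {l}"
  obtain x y where z: "opt_sol M B = (x, y)" by fastforce
  \<comment> \<open>Testing \<open>k = l\<close> first also covers the case that \<open>l\<close> is
    itself one of the identities in \<open>S\<close>.\<close>
  define x' where "x' = (\<lambda>k. if k = l then \<Sum>k\<in>S. x k else if k \<in> L then x k else 0)"
  have [simp]: "bidders (A L') = L'" for L' by (simp add: A_def)
  have finN: "finite N" and T: "?T \<subseteq> N" "N - ?T = S" using L S N by auto
  have feas: "(x, y) \<in> feasible (A N) N"
    using M B z by (auto simp: core_selecting_def optimal_def)
  have "(\<Sum>k\<in>L. x' k) = x' l + (\<Sum>k\<in>?T. x' k)"
    by (rule sum.remove[OF L])
  also have "\<dots> = (\<Sum>k\<in>S. x k) + (\<Sum>k\<in>?T. x k)"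
    by (simp add: x'_def)
  also have "\<dots> = (\<Sum>k\<in>N. x k)"
    using sum.subset_diff[OF T(1) finN, of x] T by simp
  \<comment> \<open>Equal totals give equal values of \<open>G\<close> and \<open>D\<close>, so
    feasibility and the \<open>d\<close> term carry over from \<open>N\<close> to
    \<open>L\<close>.\<close>
  finally have sum_x': "(\<Sum>k\<in>L. x' k) = (\<Sum>k\<in>N. x k)" .
  have x_nonneg: "0 \<le> x k" if "k \<in> N" for k
    using feas that by (auto simp: feasible_def allocations_def)
  have "x' \<in> allocations L"
    using L x_nonneg N by (auto simp: allocations_def x'_def intro!: sum_nonneg)
  then have feas': "(x', y) \<in> feasible (A L) L"
    using feas sum_x' by (simp add: feasible_def A_def)
  have "(\<Sum>k\<in>L. C k (x' k)) = C l (\<Sum>k\<in>S. x k) + (\<Sum>k\<in>?T. B k (x k))"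
    unfolding sum.remove[OF L, of "\<lambda>k. C k (x' k)"] using B(3)
    by (intro arg_cong2[of _ _ _ _ "(+)"] sum.cong) (auto simp: x'_def)
  then have cost': "cost (A L) C L (x', y) = C l (\<Sum>k\<in>S. x k) + cost (A N) B ?T (x, y)"
    by (simp add: cost_def sum_x' A_def)
  have "ereal ((\<Sum>k\<in>S. payment M B k) + cost (A N) B ?T (x, y)) \<le> J (A N) B ?T"
    using payments_le_J[OF _ M _ B(2), of ?T] finN B(1) T by (simp add: z)
  \<comment> \<open>Both sides reduce to the auction whose bidder set is \<open>?T\<close> itself,
    where \<open>B\<close> and \<open>C\<close> agree.\<close>
  also have "\<dots> = J (A L) C ?T"
    using J_fungible_auction[OF finN T(1), of D G B] J_fungible_auction[OF L(1), of ?T D G C]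
      J_cong[of ?T B C "A ?T"] B(3) by (auto simp: A_def)
  finally have lower: "ereal ((\<Sum>k\<in>S. payment M B k) + cost (A N) B ?T (x, y)) \<le> J (A L) C ?T" .
  have "J (A L) C L \<le> ereal (C l (\<Sum>k\<in>S. x k) + cost (A N) B ?T (x, y))"
    using J_le_cost[OF feas', of C] by (simp add: cost')
  moreover obtain j where "J (A L) C L = ereal j"
    using C by (auto simp: well_posed_def)
  ultimately show ?thesis
    using lower by (cases "J (A L) C ?T") (auto simp: vcg_utility_def xstar_def z)
qed

theorem theorem6:
  fixes L :: "'l set"
  assumes "finite L"
  shows
    "(\<forall>(A :: ('l, 't::finite, 'p::finite, 'q::finite) auction) M K c B'.
        let C' = override_on B' c K in
        bidders A = L \<and> core_selecting A M \<and> K \<subseteq> L \<and>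
        valid_profile K c \<and> valid_profile (L - K) B' \<and> well_posed A C' \<and>
        (\<forall>l\<in>K. xstar M C' l = 0)
        \<longrightarrow>
        (\<Sum>l\<in>K. utility M c C' l) = 0 \<and>
        (\<forall>b. let B = override_on B' b K in
           valid_profile K b \<and> well_posed A B \<longrightarrow>
           (\<Sum>l\<in>K. utility M c B l) \<le> (\<Sum>l\<in>K. utility M c C' l)))
     \<and>
     (\<forall>(D :: real ^ 't \<Rightarrow> real ^ 'p \<Rightarrow> real) (G :: real ^ 't \<Rightarrow> real ^ 'p \<Rightarrow> real ^ 'q)
        (M :: 'l set \<Rightarrow> ('l, 't, 'p) mechanism) l C S b.
        let A = fungible_auction D G;
            N = (L - {l}) \<union> S;
            B = override_on C b S
        in
        (\<forall>L'. finite L' \<longrightarrow> core_selecting (A L') (M L')) \<and>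
        l \<in> L \<and> valid_profile L C \<and> well_posed (A L) C \<and> J (A L) C (L - {l}) < \<infinity> \<and>
        finite S \<and> S \<inter> (L - {l}) = {} \<and> valid_profile S b \<and> well_posed (A N) B
        \<longrightarrow>
        ereal ((\<Sum>k\<in>S. payment (M N) B k) - C l (\<Sum>k\<in>S. xstar (M N) B k))
          \<le> vcg_utility (A L) C l)"
proof (intro conjI allI; unfold Let_def; intro impI; elim conjE)
  fix A :: "('l, 't, 'p, 'q) auction" and M and K :: "'l set" and c B' :: "('l, 't) profile"
  let ?C = "override_on B' c K"
  assume A: "bidders A = L" and M: "core_selecting A M" and K: "K \<subseteq> L"
    and c: "valid_profile K c" and B': "valid_profile (L - K) B'" and wp: "well_posed A ?C"
    and lose: "\<forall>l\<in>K. xstar M ?C l = 0"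
  note valid = valid_profile_override_on[OF _ B']
  \<comment> \<open>On \<open>K\<close> the profile \<open>?C\<close> coincides with
    \<open>c\<close>, so it can replace \<open>c\<close> as the cost profile, the form used in the
    lemmas.\<close>
  have util: "(\<Sum>l\<in>K. utility M c B l) = (\<Sum>l\<in>K. utility M ?C B l)" for B
    by (simp add: utility_def)
  have zero: "(\<Sum>l\<in>K. utility M c ?C l) = 0"
    using losing_utilities_sum_0[of A M K ?C] assms A M K valid[OF c] wp lose by (simp add: util)
  moreover have "(\<Sum>l\<in>K. utility M c (override_on B' b K) l) \<le> 0"
    if "valid_profile K b" "well_posed A (override_on B' b K)" for b
    using losing_group_deviation[of A M K ?C "override_on B' b K"]
      assms A M K valid[OF c] wp lose valid[OF that(1)] that(2) by (simp add: util)
  ultimately show "(\<Sum>l\<in>K. utility M c ?C l) = 0 \<and>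
      (\<forall>b. valid_profile K b \<and> well_posed A (override_on B' b K) \<longrightarrow>
        (\<Sum>l\<in>K. utility M c (override_on B' b K) l) \<le> (\<Sum>l\<in>K. utility M c ?C l))"
    by simp
next
  fix D :: "real ^ 't \<Rightarrow> real ^ 'p \<Rightarrow> real" and G :: "real ^ 't \<Rightarrow> real ^ 'p \<Rightarrow> real ^ 'q"
    and M :: "'l set \<Rightarrow> ('l, 't, 'p) mechanism" and l and C :: "('l, 't) profile" and S b
  let ?N = "(L - {l}) \<union> S" and ?B = "override_on C b S"
  assume M: "\<forall>L'. finite L' \<longrightarrow> core_selecting (fungible_auction D G L') (M L')"
    and l: "l \<in> L" and C: "valid_profile L C" "well_posed (fungible_auction D G L) C"
    and S: "finite S" "S \<inter> (L - {l}) = {}"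
    and b: "valid_profile S b" and wp: "well_posed (fungible_auction D G ?N) ?B"
  have "valid_profile ?N ?B"
    using C(1) b by (intro valid_profile_override_on) (auto simp: valid_profile_def)
  moreover have "?B k = C k" if "k \<in> L - {l}" for k
    using S(2) that by (auto simp: override_on_def)
  ultimately show "ereal ((\<Sum>k\<in>S. payment (M ?N) ?B k) - C l (\<Sum>k\<in>S. xstar (M ?N) ?B k))
      \<le> vcg_utility (fungible_auction D G L) C l"
    using M assms S(1) by (intro multiple_identities[OF assms l S refl C(2) _ _ wp]) auto
qed

end
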